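(* There exists a constant $C$ such that the following holds. Let $u(x,t)$ be a smooth solution of the Cauchy problem $$u_t+u\,u_x=-\Lambda^{-1}(u)\quad(x\in\mathbb{T}),\qquad u(x,0)=u_0(x).$$ If the initial data satisfies $$\min_{x}u_x(x,0)\le -C,$$ then $u_x(x,t)$ blows up in finite time.
   Context: $\mathbb{T}=\mathbb{R}/2\pi\mathbb{Z}$, identified with $[-\pi,\pi]$; functions are real-valued. The operator $\Lambda^{-1}$ is $$\Lambda^{-1}(u)(x)=-\frac{1}{2\pi}\int_{-\pi}^{\pi}\log\Big(4\sin^2\Big(\frac{x-\beta}{2}\Big)\Big)u(\beta)\,d\beta.$$ "$u_x$ blows up in finite time" means that there is a finite $T^*$ such that the smooth solution cannot be continued up to time $T^*$ with $\|u_x(\cdot,t)\|_{L^\infty}$ remaining bounded. *)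

theory Defs
  imports "HOL-Analysis.Analysis"
begin

text \<open>
  Functions on the circle are functions on the real line of period \<open>2 * pi\<close>.
  A function of time and space is written \<open>u t x\<close>, with time first.
\<close>

text \<open>
  \<open>k\<close> times continuously differentiable on \<open>S\<close>, with derivatives taken within \<open>S\<close> (one-sided at
  boundary points). It is used below for a strip \<open>{0..<T} \<times> UNIV\<close>, on which Frechet derivatives
  within the set are unique, so the choice of \<open>f'\<close> is forced.
\<close>

primrec Ck_on :: "nat \<Rightarrow> ('a::real_normed_vector \<Rightarrow> 'b::real_normed_vector) \<Rightarrow> 'a set \<Rightarrow> bool" where
  "Ck_on 0 f S \<longleftrightarrow> continuous_on S f"
| "Ck_on (Suc k) f S \<longleftrightarrow>
     (\<exists>f'. (\<forall>z\<in>S. (f has_derivative f' z) (at z within S)) \<and> (\<forall>h. Ck_on k (\<lambda>z. f' z h) S))"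

definition smooth_on :: "('a::real_normed_vector \<Rightarrow> 'b::real_normed_vector) \<Rightarrow> 'a set \<Rightarrow> bool" where
  "smooth_on f S \<longleftrightarrow> (\<forall>k. Ck_on k f S)"

text \<open>
  The logarithm is singular only where the sine vanishes, a null set, so the library value
  \<open>ln 0 = 0\<close> has no effect on the integral.
\<close>

definition Lambda_inv :: "(real \<Rightarrow> real) \<Rightarrow> real \<Rightarrow> real" where
  "Lambda_inv u x =
     - 1 / (2 * pi) * integral {-pi..pi} (\<lambda>\<beta>. ln (4 * (sin ((x - \<beta>) / 2))\<^sup>2) * u \<beta>)"

text \<open>The time interval \<open>[0, T)\<close>, where \<open>T = \<infinity>\<close> is allowed.\<close>

definition time_interval :: "ereal \<Rightarrow> real set" where
  "time_interval T = {t. 0 \<le> t \<and> ereal t < T}"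

definition smooth_solution :: "ereal \<Rightarrow> (real \<Rightarrow> real) \<Rightarrow> (real \<Rightarrow> real \<Rightarrow> real) \<Rightarrow> bool" where
  "smooth_solution T u0 u \<longleftrightarrow>
     smooth_on (\<lambda>(t, x). u t x) (time_interval T \<times> UNIV) \<and>
     (\<forall>t\<in>time_interval T. \<forall>x. u t (x + 2 * pi) = u t x) \<and>
     (\<forall>t\<in>time_interval T. \<forall>x. \<exists>ut.
        ((\<lambda>s. u s x) has_real_derivative ut) (at t within time_interval T) \<and>
        ut + u t x * deriv (u t) x = - Lambda_inv (u t) x) \<and>
     (\<forall>x. u 0 x = u0 x)"

text \<open>
  For the smooth solution \<open>u\<close> on \<open>[0, T)\<close>: there is a finite time \<open>Tstar\<close> such that no smooth
  solution on \<open>[0, Tstar)\<close> which agrees with \<open>u\<close> at the common times has bounded space derivative.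
  If \<open>Tstar \<le> T\<close>, the restriction of \<open>u\<close> is itself such a solution, so its space derivative is then
  unbounded on \<open>[0, Tstar)\<close>.
\<close>

definition ux_blows_up :: "ereal \<Rightarrow> (real \<Rightarrow> real) \<Rightarrow> (real \<Rightarrow> real \<Rightarrow> real) \<Rightarrow> bool" where
  "ux_blows_up T u0 u \<longleftrightarrow>
     (\<exists>Tstar::real. 0 < Tstar \<and>
        \<not> (\<exists>v. smooth_solution (ereal Tstar) u0 v \<and>
               (\<forall>t\<in>time_interval T \<inter> time_interval (ereal Tstar). \<forall>x. v t x = u t x) \<and>
               bounded ((\<lambda>(t, x). deriv (v t) x) ` (time_interval (ereal Tstar) \<times> UNIV))))"

end

(*
  Put c = ln 4 - (the mean of ln (4 sin^2 (x/2))). Since 4 sin^2 is at most 4, Lambda_inv is, up to a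
  multiple of the mean, convolution with the nonnegative kernel (ln 4 - ln (4 sin^2 (x/2))) / (2 pi)
  of mass c, so the derivative of Lambda_inv g is at least c * min g'. Differentiating the equation
  in x at a point where u_x attains its minimum m gives u_xt <= - m^2 - c m. For m <= - (c + 2) this
  is steeper than the barrier - (c + 2) / (1 - t), hence m stays below the barrier and tends to
  minus infinity before t = 1.
*)
theory Submission
  imports Defs
begin

section \<open>Periodic functions on the real line\<close>

lemma periodic_plus_of_int:
  fixes f :: "real \<Rightarrow> 'a"
  assumes "\<And>x. f (x + p) = f x"
  shows "f (x + of_int n * p) = f x"
proof (induction n rule: int_induct[of _ 0])
  case (step1 i)
  then show ?case using assms[of "x + of_int i * p"] by (simp add: algebra_simps)
next
  case (step2 i)
  then show ?case using assms[of "x + of_int (i - 1) * p"] by (simp add: algebra_simps)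
qed simp

lemma obtain_period_translate:
  fixes a p x :: real
  assumes "0 < p"
  obtains n where "x - of_int n * p \<in> {a..a + p}"
proof
  define n where "n = \<lfloor>(x - a) / p\<rfloor>"
  have "of_int n \<le> (x - a) / p" "(x - a) / p < of_int n + 1"
    unfolding n_def by linarith+
  then show "x - of_int n * p \<in> {a..a + p}"
    using assms by (auto simp: field_simps)
qed

text \<open>A translation of \<open>b\<close> by whole periods lands at a point \<open>b'\<close> of
  \<open>{a..a + p}\<close>. Cutting there and moving the left piece one period to the right gives
  the integral over \<open>{b'..b' + p}\<close>, which is then translated back to
  \<open>b\<close>.\<close>

lemma periodic_has_integral_shift:
  fixes f :: "real \<Rightarrow> real"
  assumes p: "0 < p" and per: "\<And>x. f (x + p) = f x" and int: "(f has_integral I) {a..a + p}"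
  shows "(f has_integral I) {b..b + p}"
proof -
  obtain n where n: "b - of_int n * p \<in> {a..a + p}"
    using obtain_period_translate[OF p] .
  define b' where "b' = b - of_int n * p"
  have b': "a \<le> b'" "b' \<le> a + p"
    using n by (auto simp: b'_def)
  have "f integrable_on {a..a + p}"
    using int by blast
  then have "f integrable_on {a..b'}" "f integrable_on {b'..a + p}"
    by (rule integrable_on_subinterval; use b' in auto)+
  then obtain I1 I2 where I: "(f has_integral I1) {a..b'}" "(f has_integral I2) {b'..a + p}"
    by blast
  have "I = I1 + I2"
    using has_integral_combine[OF b' I] int has_integral_unique by blast
  have "f \<circ> (+) p = f"
    using per by (auto simp: add.commute)
  then have "(f has_integral I1) {a + p..b' + p}"
    using has_integral_shift_Icc_real[of f p I1 a b'] I by simp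
  then have "(f has_integral I) {b'..b' + p}"
    using has_integral_combine[OF _ _ I(2), of "b' + p" I1] b' \<open>I = I1 + I2\<close>
    by (simp add: add.commute)
  moreover have "f \<circ> (+) (of_int n * p) = f"
    using periodic_plus_of_int[of f, OF per] by (auto simp: add.commute)
  ultimately have "(f has_integral I) {b' + of_int n * p..b' + p + of_int n * p}"
    using has_integral_shift_Icc_real[of f "of_int n * p" I b' "b' + p"] by simp
  then show ?thesis
    by (simp add: b'_def algebra_simps)
qed

section \<open>The nonnegative logarithmic kernel and its convolution\<close>

lemma sin_ge_chord:
  fixes y :: real
  assumes "0 \<le> y" "y \<le> pi / 2"
  shows "2 * y / pi \<le> sin y"
proof -
  have "concave_on {0..pi / 2} sin"
    by (rule f''_le0_imp_concave[where f' = cos and f'' = "\<lambda>x. - sin x"])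
       (auto intro!: derivative_eq_intros sin_ge_zero)
  from concave_onD[OF this, of "2 * y / pi" 0 "pi / 2"] assms show ?thesis
    by (simp add: field_simps)
qed

text \<open>The junk value \<open>ln 0 = 0\<close> at \<open>\<beta> = 0\<close> keeps the kernel nonnegative everywhere.\<close>

definition pos_log_kernel :: "real \<Rightarrow> real" where
  "pos_log_kernel \<beta> = (ln 4 - ln (4 * (sin (\<beta> / 2))\<^sup>2)) / (2 * pi)"

lemma pos_log_kernel_nonneg: "0 \<le> pos_log_kernel \<beta>"
proof (cases "sin (\<beta> / 2) = 0")
  case False
  then have "ln (4 * (sin (\<beta> / 2))\<^sup>2) \<le> ln 4"
    by (subst ln_le_cancel_iff) (auto simp: abs_square_le_1)
  then show ?thesis
    by (simp add: pos_log_kernel_def)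
qed (simp add: pos_log_kernel_def)

lemma pos_log_kernel_minus [simp]: "pos_log_kernel (- \<beta>) = pos_log_kernel \<beta>"
  by (simp add: pos_log_kernel_def)

lemma pos_log_kernel_periodic [simp]: "pos_log_kernel (\<beta> + 2 * pi) = pos_log_kernel \<beta>"
proof -
  have "(\<beta> + 2 * pi) / 2 = \<beta> / 2 + pi"
    by simp
  then show ?thesis
    unfolding pos_log_kernel_def by (simp only: sin_periodic_pi power2_minus)
qed

text \<open>Supplies the integrable majorant of the logarithmic singularity: the chord bound keeps
  the sine above \<open>\<beta> / pi\<close>, and a logarithm is dominated by a power.\<close>

lemma pos_log_kernel_le_powr:
  assumes "0 < \<beta>" "\<beta> \<le> pi"
  shows "pos_log_kernel \<beta> \<le> 2 / sqrt pi * \<beta> powr (- 1 / 2)"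
proof -
  define s where "s = sin (\<beta> / 2)"
  have s: "\<beta> / pi \<le> s"
    using sin_ge_chord[of "\<beta> / 2"] assms by (simp add: s_def)
  moreover have bp: "0 < \<beta> / pi"
    using assms by simp
  ultimately have "0 < s"
    by linarith
  \<comment> \<open>The square root is there for the exponent: \<open>ln z \<le> z\<close> at
    \<open>z = 1 / sqrt s\<close> leads to \<beta> to the power -1/2, whereas
    \<open>z = 1 / s\<close> would lead to the power -1, which is not integrable at 0.\<close>
  have "2 * pi * pos_log_kernel \<beta> = - 4 * ln (sqrt s)"
    using \<open>0 < s\<close> by (simp add: pos_log_kernel_def ln_mult ln_sqrt ln_realpow flip: s_def)
  also have "\<dots> = 4 * ln (1 / sqrt s)"
    using \<open>0 < s\<close> by (simp add: ln_div)
  also have "\<dots> \<le> 4 * (1 / sqrt s)"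
    using \<open>0 < s\<close> ln_bound[of "1 / sqrt s"] by simp
  also have "\<dots> \<le> 4 * (1 / sqrt (\<beta> / pi))"
    using s bp \<open>0 < s\<close> by (intro mult_left_mono divide_left_mono) auto
  also have "\<dots> = 4 * sqrt pi * \<beta> powr (- 1 / 2)"
    using assms by (simp add: real_sqrt_divide powr_minus powr_half_sqrt field_simps)
  finally have "pos_log_kernel \<beta> \<le> 4 * sqrt pi * \<beta> powr (- 1 / 2) / (2 * pi)"
    by (simp add: field_simps)
  also have "\<dots> = 2 / sqrt pi * \<beta> powr (- 1 / 2)"
    by (simp add: field_simps real_sqrt_mult_self flip: real_sqrt_mult)
  finally show ?thesis .
qed

lemma pos_log_kernel_borel [measurable]: "pos_log_kernel \<in> borel_measurable borel"
  unfolding pos_log_kernel_def by measurable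

lemma pos_log_kernel_absolutely_integrable: "pos_log_kernel absolutely_integrable_on {-pi..pi}"
proof -
  have "pos_log_kernel integrable_on {0<..pi}"
  proof (rule measurable_bounded_by_integrable_imp_integrable_real)
    show "pos_log_kernel \<in> borel_measurable (lebesgue_on {0<..pi})"
      by (intro measurable_restrict_space1 measurable_completion) simp
    show "(\<lambda>\<beta>. 2 / sqrt pi * \<beta> powr (- 1 / 2)) integrable_on {0<..pi}"
      by (intro integrable_on_mult_right integrable_on_powr_from_0') auto
    show "\<bar>pos_log_kernel \<beta>\<bar> \<le> 2 / sqrt pi * \<beta> powr (- 1 / 2)" if "\<beta> \<in> {0<..pi}" for \<beta>
      using that pos_log_kernel_le_powr[of \<beta>] pos_log_kernel_nonneg[of \<beta>] by auto
  qed auto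
  \<comment> \<open>Adding the null set {0} closes the interval; evenness of the kernel then covers
    the negative half.\<close>
  then have pos: "pos_log_kernel integrable_on {0..pi}"
    by (rule integrable_spike_set) (auto intro!: negligible_subset[OF negligible_sing[of 0]])
  then have "pos_log_kernel integrable_on {-pi..0}"
    using Henstock_Kurzweil_Integration.integrable_reflect_real
      [where f = pos_log_kernel and a = 0 and b = pi] by simp
  then have "pos_log_kernel integrable_on {-pi..pi}"
    using pos by (intro Henstock_Kurzweil_Integration.integrable_combine[of "-pi" 0 pi]) auto
  then show ?thesis
    by (intro nonnegative_absolutely_integrable_1 pos_log_kernel_nonneg)
qed

lemma pos_log_kernel_mult_integrable:
  assumes "continuous_on UNIV g"
  shows "(\<lambda>\<beta>. pos_log_kernel \<beta> * g \<beta>) integrable_on {-pi..pi}"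
proof -
  have "(\<lambda>\<beta>. g \<beta> * pos_log_kernel \<beta>) absolutely_integrable_on {-pi..pi}"
  proof (rule absolutely_integrable_bounded_measurable_product_real)
    show "g \<in> borel_measurable (lebesgue_on {-pi..pi})"
      using assms by (intro continuous_imp_measurable_on_sets_lebesgue continuous_on_subset[OF assms]) auto
    show "bounded (g ` {-pi..pi})"
      using assms by (intro compact_imp_bounded compact_continuous_image continuous_on_subset[OF assms]) auto
  qed (auto intro: pos_log_kernel_absolutely_integrable)
  then show ?thesis
    by (simp add: absolutely_integrable_on_def mult.commute)
qed

text \<open>Splitting the logarithm as \<open>ln 4\<close> minus a multiple of the kernel separates
  a term independent of \<open>x\<close>. In the other term, periodicity of kernel and
  \<open>g\<close> lets the integration variable be translated by \<open>x\<close>, so that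
  \<open>x\<close> occurs only in the argument of \<open>g\<close>.\<close>

lemma Lambda_inv_eq_pos_log_kernel:
  assumes cont: "continuous_on UNIV g" and per: "\<And>x. g (x + 2 * pi) = g x"
  shows "Lambda_inv g x = integral {-pi..pi} (\<lambda>\<beta>. pos_log_kernel \<beta> * g (\<beta> + x))
    - ln 4 / (2 * pi) * integral {-pi..pi} g"
proof -
  let ?f = "\<lambda>\<beta>. pos_log_kernel (\<beta> - x) * g \<beta>"
  define I where "I = integral {-pi..pi} (\<lambda>\<beta>. pos_log_kernel \<beta> * g (\<beta> + x))"
  have "continuous_on UNIV (\<lambda>\<beta>. g (\<beta> + x))"
    by (intro continuous_intros continuous_on_compose2[OF cont]) auto
  then have "((\<lambda>\<beta>. pos_log_kernel \<beta> * g (\<beta> + x)) has_integral I) {-pi..pi}"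
    unfolding I_def by (intro integrable_integral pos_log_kernel_mult_integrable)
  moreover have "(\<lambda>\<beta>. pos_log_kernel \<beta> * g (\<beta> + x)) = ?f \<circ> (+) x"
    by (auto simp: add.commute)
  ultimately have "(?f has_integral I) {-pi + x..pi + x}"
    using has_integral_shift_Icc_real[of ?f x I "-pi" pi] by simp
  moreover have "?f (\<beta> + 2 * pi) = ?f \<beta>" for \<beta>
    using pos_log_kernel_periodic[of "\<beta> - x"] per[of \<beta>] by (simp add: algebra_simps)
  ultimately have 1: "(?f has_integral I) {-pi..pi}"
    using periodic_has_integral_shift[of "2 * pi" ?f I "-pi + x" "-pi"] by (simp add: algebra_simps)
  have 2: "(g has_integral integral {-pi..pi} g) {-pi..pi}"
    using cont by (intro integrable_integral integrable_continuous_real continuous_on_subset[OF cont]) auto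
  \<comment> \<open>This holds also where the sine vanishes, since the kernel is defined with the
    same value of \<open>ln 0\<close>.\<close>
  have eq: "ln (4 * (sin ((x - \<beta>) / 2))\<^sup>2) * g \<beta> = ln 4 * g \<beta> - 2 * pi * ?f \<beta>" for \<beta>
    using pos_log_kernel_minus[of "\<beta> - x"] by (simp add: pos_log_kernel_def left_diff_distrib)
  have "((\<lambda>\<beta>. ln (4 * (sin ((x - \<beta>) / 2))\<^sup>2) * g \<beta>) has_integral
      ln 4 * integral {-pi..pi} g - 2 * pi * I) {-pi..pi}"
    using has_integral_diff[OF has_integral_mult_right[OF 2, of "ln 4"]
        has_integral_mult_right[OF 1, of "2 * pi"]]
    unfolding eq .
  then show ?thesis
    unfolding Lambda_inv_def I_def[symmetric] by (simp add: integral_unique field_simps)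
qed

text \<open>In an increment of \<open>Lambda_inv g\<close> the mean term cancels, and what remains
  is an increment of \<open>g\<close> integrated against a nonnegative kernel. Bounding increments
  of \<open>g\<close> instead of its derivative avoids differentiating under the singular
  integral.\<close>

lemma Lambda_inv_deriv_ge:
  assumes cont: "continuous_on UNIV g" and per: "\<And>x. g (x + 2 * pi) = g x"
    and slope: "\<And>y h. 0 < h \<Longrightarrow> m * h \<le> g (y + h) - g y"
    and deriv: "(Lambda_inv g has_real_derivative D) (at x)"
  shows "m * integral {-pi..pi} pos_log_kernel \<le> D"
proof -
  have int: "(\<lambda>\<beta>. pos_log_kernel \<beta> * g (\<beta> + z)) integrable_on {-pi..pi}" for z
    by (intro pos_log_kernel_mult_integrable continuous_on_compose2[OF cont]) (auto intro: continuous_intros)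
  have "m * integral {-pi..pi} pos_log_kernel \<le> (Lambda_inv g (x + h) - Lambda_inv g x) / h"
    if "0 < h" for h
  proof -
    have "m * h * integral {-pi..pi} pos_log_kernel
        = integral {-pi..pi} (\<lambda>\<beta>. pos_log_kernel \<beta> * (m * h))"
      by (simp add: mult.commute)
    also have "\<dots> \<le> integral {-pi..pi}
        (\<lambda>\<beta>. pos_log_kernel \<beta> * g (\<beta> + (x + h)) - pos_log_kernel \<beta> * g (\<beta> + x))"
    proof (rule integral_le)
      show "(\<lambda>\<beta>. pos_log_kernel \<beta> * (m * h)) integrable_on {-pi..pi}"
        by (intro pos_log_kernel_mult_integrable continuous_intros)
      show "pos_log_kernel \<beta> * (m * h)
          \<le> pos_log_kernel \<beta> * g (\<beta> + (x + h)) - pos_log_kernel \<beta> * g (\<beta> + x)" for \<beta>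
        using mult_left_mono[OF slope[OF that, of "\<beta> + x"] pos_log_kernel_nonneg[of \<beta>]]
        by (simp add: algebra_simps)
    qed (intro integrable_diff int)
    also have "\<dots> = Lambda_inv g (x + h) - Lambda_inv g x"
      by (simp add: Lambda_inv_eq_pos_log_kernel[OF cont per] integral_diff[OF int int])
    finally show ?thesis
      using that by (simp add: field_simps)
  qed
  \<comment> \<open>The bound on the quotient is available for positive \<open>h\<close>, and the
    right-hand limit already determines \<open>D\<close>.\<close>
  moreover have "((\<lambda>h. (Lambda_inv g (x + h) - Lambda_inv g x) / h) \<longlongrightarrow> D) (at_right 0)"
    using deriv unfolding DERIV_def by (rule tendsto_mono[rotated]) (simp add: at_le)
  ultimately show ?thesis
    by (intro tendsto_lowerbound[where F = "at_right 0"]) (auto simp: eventually_at_right_less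
        intro!: eventually_at_rightI[of 0 1])
qed

section \<open>Partial derivatives and their interchange\<close>

lemma has_real_derivative_partials:
  fixes F :: "real \<times> real \<Rightarrow> real"
  assumes F: "(F has_derivative F') (at (t, x) within A \<times> UNIV)" and t: "t \<in> A"
  shows "((\<lambda>y. F (t, y)) has_real_derivative F' (0, 1)) (at x)"
    and "((\<lambda>s. F (s, x)) has_real_derivative F' (1, 0)) (at t within A)"
proof -
  interpret F': bounded_linear F'
    using F by (rule has_derivative_bounded_linear)
  have "((\<lambda>y. F (t, y)) has_derivative (\<lambda>h. F' (0, h))) (at x)"
  proof (rule has_derivative_in_compose[where f = "Pair t" and f' = "Pair 0" and g = F])
    show "(Pair t has_derivative Pair 0) (at x)"
      by (intro has_derivative_Pair has_derivative_const has_derivative_ident)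
    show "(F has_derivative F') (at (t, x) within range (Pair t))"
      by (rule has_derivative_subset[OF F]) (use t in auto)
  qed
  moreover have "(\<lambda>h. F' (0, h)) = (*) (F' (0, 1))"
  proof
    show "F' (0, h) = F' (0, 1) * h" for h
      using F'.scaleR[of h "(0, 1)"] by (simp add: mult.commute)
  qed
  ultimately show "((\<lambda>y. F (t, y)) has_real_derivative F' (0, 1)) (at x)"
    unfolding has_field_derivative_def by (rule has_derivative_eq_rhs)
  have "((\<lambda>s. F (s, x)) has_derivative (\<lambda>h. F' (h, 0))) (at t within A)"
  proof (rule has_derivative_in_compose[where f = "\<lambda>s. (s, x)" and f' = "\<lambda>h. (h, 0)" and g = F])
    show "((\<lambda>s. (s, x)) has_derivative (\<lambda>h. (h, 0))) (at t within A)"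
      by (intro has_derivative_Pair has_derivative_const has_derivative_ident)
    show "(F has_derivative F') (at (t, x) within (\<lambda>s. (s, x)) ` A)"
      by (rule has_derivative_subset[OF F]) auto
  qed
  moreover have "(\<lambda>h. F' (h, 0)) = (*) (F' (1, 0))"
  proof
    show "F' (h, 0) = F' (1, 0) * h" for h
      using F'.scaleR[of h "(1, 0)"] by (simp add: mult.commute)
  qed
  ultimately show "((\<lambda>s. F (s, x)) has_real_derivative F' (1, 0)) (at t within A)"
    unfolding has_field_derivative_def by (rule has_derivative_eq_rhs)
qed

text \<open>By the fundamental theorem \<open>f s - f a\<close> is the time integral of
  \<open>ft\<close>. Continuity of \<open>ftx\<close> permits differentiation in space under this
  integral, so \<open>fx s - fx a\<close> is the time integral of \<open>ftx\<close>;
  differentiating in \<open>s\<close> finishes, one-sidedly at the endpoints.\<close>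

lemma mixed_partials_commute:
  fixes f ft fx ftx :: "real \<Rightarrow> real \<Rightarrow> real"
  assumes ft: "\<And>s x. s \<in> {a..b} \<Longrightarrow> ((\<lambda>s. f s x) has_real_derivative ft s x) (at s within {a..b})"
    and fx: "\<And>s x. s \<in> {a..b} \<Longrightarrow> (f s has_real_derivative fx s x) (at x)"
    and ftx: "\<And>s x. s \<in> {a..b} \<Longrightarrow> (ft s has_real_derivative ftx s x) (at x)"
    and cont: "continuous_on ({a..b} \<times> UNIV) (\<lambda>(s, x). ftx s x)"
    and t: "t \<in> {a..b}"
  shows "((\<lambda>s. fx s x) has_real_derivative ftx t x) (at t within {a..b})"
proof -
  have eq: "fx s x = fx a x + integral {a..s} (\<lambda>\<tau>. ftx \<tau> x)" if s: "s \<in> {a..b}" for s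
  proof -
    have int: "((\<lambda>\<tau>. ft \<tau> y) has_integral f s y - f a y) {a..s}" for y
    proof (rule fundamental_theorem_of_calculus)
      fix \<tau> assume "\<tau> \<in> {a..s}"
      then show "((\<lambda>s. f s y) has_vector_derivative ft \<tau> y) (at \<tau> within {a..s})"
        using s ft[of \<tau> y] has_field_derivative_subset[of _ _ \<tau> "{a..b}" "{a..s}"]
        by (auto simp flip: has_real_derivative_iff_has_vector_derivative)
    qed (use s in auto)
    have "((\<lambda>y. integral (cbox a s) (\<lambda>\<tau>. ft \<tau> y)) has_real_derivative
        integral (cbox a s) (\<lambda>\<tau>. ftx \<tau> x)) (at x within UNIV)"
    proof (rule leibniz_rule_field_derivative)
      show "(ft \<tau> has_real_derivative ftx \<tau> y) (at y)" if "\<tau> \<in> cbox a s" for y \<tau>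
        using ftx that s by auto
      show "(\<lambda>\<tau>. ft \<tau> y) integrable_on cbox a s" for y
        using int by auto
      have "continuous_on (UNIV \<times> cbox a s) (\<lambda>z. case prod.swap z of (s, x) \<Rightarrow> ftx s x)"
        by (rule continuous_on_compose2[OF cont continuous_on_swap]) (use s in auto)
      then show "continuous_on (UNIV \<times> cbox a s) (\<lambda>(y, \<tau>). ftx \<tau> y)"
        by (simp add: case_prod_beta)
    qed auto
    then have "((\<lambda>y. f s y - f a y) has_real_derivative integral {a..s} (\<lambda>\<tau>. ftx \<tau> x)) (at x)"
      using int[THEN integral_unique] by simp
    moreover have "((\<lambda>y. f s y - f a y) has_real_derivative fx s x - fx a x) (at x)"
      using s by (intro derivative_intros fx) auto
    ultimately show ?thesis
      using DERIV_unique by fastforce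
  qed
  have "continuous_on {a..b} (\<lambda>\<tau>. ftx \<tau> x)"
    using continuous_on_compose2[OF cont, of "{a..b}" "\<lambda>\<tau>. (\<tau>, x)"]
    by (simp add: continuous_intros image_subset_iff)
  then have "((\<lambda>s. fx a x + integral {a..s} (\<lambda>\<tau>. ftx \<tau> x)) has_real_derivative 0 + ftx t x)
      (at t within {a..b})"
    using t by (intro derivative_intros integral_has_real_derivative)
  then have "((\<lambda>s. fx s x) has_real_derivative 0 + ftx t x) (at t within {a..b})"
    by (rule has_field_derivative_transform_within[OF _ zero_less_one t]) (rule eq[symmetric])
  then show ?thesis
    by simp
qed

section \<open>The minimal slope of a smooth solution\<close>

lemma time_interval_ereal: "time_interval (ereal T) = {0..<T}"
  by (auto simp: time_interval_def)

text \<open>Two orders of smoothness suffice. Differentiability of \<open>Lambda_inv (v t)\<close>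
  is read off from the equation, which expresses it through \<open>v\<close> and its first
  derivatives; the last clause is the equation differentiated in space.\<close>

lemma smooth_solution_partials:
  assumes sol: "smooth_solution (ereal T) u0 v"
  obtains vx vxx vtx :: "real \<Rightarrow> real \<Rightarrow> real" where
    "continuous_on ({0..<T} \<times> UNIV) (\<lambda>(t, x). vx t x)"
    "\<And>t x. t \<in> {0..<T} \<Longrightarrow> (v t has_real_derivative vx t x) (at x)"
    "\<And>t x. t \<in> {0..<T} \<Longrightarrow> (vx t has_real_derivative vxx t x) (at x)"
    "\<And>t x. t \<in> {0..<T} \<Longrightarrow> ((\<lambda>s. vx s x) has_real_derivative vtx t x) (at t within {0..<T})"
    "\<And>t x. t \<in> {0..<T} \<Longrightarrow> (Lambda_inv (v t) has_real_derivative
        - (vtx t x + (vx t x)\<^sup>2 + v t x * vxx t x)) (at x)"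
proof -
  let ?S = "{0..<T} \<times> (UNIV :: real set)"
  let ?F = "\<lambda>(t, x). v t x"
  have "Ck_on (Suc (Suc 0)) ?F ?S"
    using sol unfolding smooth_solution_def smooth_on_def time_interval_ereal by blast
  then obtain F' where F': "\<And>z. z \<in> ?S \<Longrightarrow> (?F has_derivative F' z) (at z within ?S)"
    and C1: "\<And>h. Ck_on (Suc 0) (\<lambda>z. F' z h) ?S"
    by (auto simp only: Ck_on.simps(2))
  from C1 have "\<exists>G. (\<forall>z\<in>?S. ((\<lambda>z. F' z h) has_derivative G z) (at z within ?S)) \<and>
      (\<forall>k. continuous_on ?S (\<lambda>z. G z k))" for h
    by simp
  then obtain F'' where
    F'': "\<And>h z. z \<in> ?S \<Longrightarrow> ((\<lambda>z. F' z h) has_derivative F'' h z) (at z within ?S)"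
    and cont: "\<And>h k. continuous_on ?S (\<lambda>z. F'' h z k)"
    by metis
  define vx where "vx t x = F' (t, x) (0, 1)" for t x
  define vt where "vt t x = F' (t, x) (1, 0)" for t x
  define vxx where "vxx t x = F'' (0, 1) (t, x) (0, 1)" for t x
  define vtx where "vtx t x = F'' (1, 0) (t, x) (0, 1)" for t x
  have cont_vx: "continuous_on ?S (\<lambda>(t, x). vx t x)"
    using F''[of _ "(0, 1)"] unfolding vx_def split_beta prod.collapse
    by (meson continuous_on_eq_continuous_within has_derivative_continuous)
  have vx: "(v t has_real_derivative vx t x) (at x)"
    and vt: "((\<lambda>s. v s x) has_real_derivative vt t x) (at t within {0..<T})"
    and vxx: "(vx t has_real_derivative vxx t x) (at x)"
    and vtx: "(vt t has_real_derivative vtx t x) (at x)" if "t \<in> {0..<T}" for t x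
    using has_real_derivative_partials[OF F' that] has_real_derivative_partials[OF F'' that] that
    unfolding vx_def vt_def vxx_def vtx_def by auto
  have vxt: "((\<lambda>s. vx s x) has_real_derivative vtx t x) (at t within {0..<T})"
    if t: "t \<in> {0..<T}" for t x
  proof -
    \<comment> \<open>The interchange of derivatives is stated on a closed interval. Any endpoint
      strictly between \<open>t\<close> and \<open>T\<close> works, because near \<open>t\<close>
      the two time sets then coincide, also when \<open>t = 0\<close>.\<close>
    define b where "b = (t + T) / 2"
    have b: "t < b" "{0..b} \<subseteq> {0..<T}"
      using t by (auto simp: b_def)
    have "((\<lambda>s. vx s x) has_real_derivative vtx t x) (at t within {0..b})"
    proof (rule mixed_partials_commute[where f = v and ft = vt and fx = vx and ftx = vtx])
      show "((\<lambda>s. v s y) has_real_derivative vt s y) (at s within {0..b})" if "s \<in> {0..b}" for s y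
        using that b(2) by (intro has_field_derivative_subset[OF vt]) auto
      show "continuous_on ({0..b} \<times> UNIV) (\<lambda>(s, x). vtx s x)"
        unfolding vtx_def split_beta prod.collapse
        by (rule continuous_on_subset[OF cont]) (use b in auto)
    qed (use b t vx vtx in auto)
    moreover have "at t within {0..b} = at t within {0..<T}"
      by (rule at_within_nhd[of t "{..<b}"]) (use b in auto)
    ultimately show ?thesis
      by simp
  qed
  have "(Lambda_inv (v t) has_real_derivative - (vtx t x + (vx t x)\<^sup>2 + v t x * vxx t x)) (at x)"
    if t: "t \<in> {0..<T}" for t x
  proof -
    have "Lambda_inv (v t) y = - (vt t y + v t y * vx t y)" for y
    proof -
      obtain ut where ut: "((\<lambda>s. v s y) has_real_derivative ut) (at t within {0..<T})"
        "ut + v t y * deriv (v t) y = - Lambda_inv (v t) y"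
        using sol t unfolding smooth_solution_def time_interval_ereal by blast
      \<comment> \<open>Derivatives within the interval are unique at a limit point, which
        identifies the \<open>ut\<close> of the equation with \<open>vt\<close>.\<close>
      have "t islimpt {0..<T}"
        by (rule islimpt_subset[OF islimpt_greaterThanLessThan1[of t T]]) (use t in auto)
      then have "ut = vt t y"
        using has_field_derivative_unique[OF ut(1) vt[OF t]] by (simp add: trivial_limit_within)
      then show ?thesis
        using ut(2) DERIV_imp_deriv[OF vx[OF t]] by simp
    qed
    then have "Lambda_inv (v t) = (\<lambda>y. - (vt t y + v t y * vx t y))"
      by blast
    then show ?thesis
      by (auto intro!: derivative_eq_intros vtx vx vxx t simp: power2_eq_square)
  qed
  then show ?thesis
    using that cont_vx vx vxx vxt by blast
qed

text \<open>At a minimum of the slope \<open>vxx\<close> vanishes, which removes the transport term.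
  By the mean value theorem the minimal slope bounds all increments of \<open>v t\<close>, so
  \<open>Lambda_inv_deriv_ge\<close> applies with it as \<open>m\<close>.\<close>

lemma smooth_solution_ux_at_min:
  fixes v :: "real \<Rightarrow> real \<Rightarrow> real"
  defines "c \<equiv> integral {-pi..pi} pos_log_kernel"
  assumes per: "\<And>x. v t (x + 2 * pi) = v t x"
    and vx: "\<And>x. (v t has_real_derivative vx x) (at x)"
    and vxx: "\<And>x. (vx has_real_derivative vxx x) (at x)"
    and Lambda: "\<And>x. (Lambda_inv (v t) has_real_derivative
        - (vtx x + (vx x)\<^sup>2 + v t x * vxx x)) (at x)"
  obtains x0 where "x0 \<in> {-pi..pi}" "\<And>y. vx x0 \<le> vx y" "vtx x0 \<le> - (vx x0)\<^sup>2 - c * vx x0"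
proof -
  have vx_per: "vx (x + 2 * pi) = vx x" for x
  proof -
    have "((\<lambda>y. v t (y + 2 * pi)) has_real_derivative vx (x + 2 * pi)) (at x)"
      using vx[of "x + 2 * pi"] by (subst (asm) DERIV_shift)
    then show ?thesis
      using per DERIV_unique[OF _ vx] by simp
  qed
  have "continuous_on {-pi..pi} vx"
    using vxx by (meson DERIV_continuous continuous_at_imp_continuous_on)
  then obtain x0 where x0: "x0 \<in> {-pi..pi}" "\<And>y. y \<in> {-pi..pi} \<Longrightarrow> vx x0 \<le> vx y"
    using continuous_attains_inf[of "{-pi..pi}" vx] by auto
  \<comment> \<open>The minimum over one period must be global: \<open>x0\<close> may be an endpoint
    of \<open>{-pi..pi}\<close>, where the interior criterion for \<open>vxx\<close> needs
    neighbours on both sides.\<close>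
  have min: "vx x0 \<le> vx y" for y
  proof -
    obtain n where n: "y - of_int n * (2 * pi) \<in> {-pi..-pi + 2 * pi}"
      using obtain_period_translate[of "2 * pi" y "-pi"] by auto
    then have "vx x0 \<le> vx (y - of_int n * (2 * pi))"
      by (intro x0) simp
    then show ?thesis
      using periodic_plus_of_int[of vx "2 * pi" "y - of_int n * (2 * pi)" n, OF vx_per] by simp
  qed
  have "vxx x0 = 0"
    by (rule DERIV_local_min[OF vxx zero_less_one]) (use min in auto)
  moreover have "vx x0 * c \<le> - (vtx x0 + (vx x0)\<^sup>2 + v t x0 * vxx x0)"
    unfolding c_def
  proof (rule Lambda_inv_deriv_ge[OF _ per _ Lambda])
    show "continuous_on UNIV (v t)"
      using vx by (meson DERIV_continuous continuous_at_imp_continuous_on)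
    show "vx x0 * h \<le> v t (y + h) - v t y" if "0 < h" for y h
    proof -
      obtain z where "v t (y + h) - v t y = (y + h - y) * vx z"
        using MVT2[of y "y + h" "v t" vx] vx \<open>0 < h\<close> by auto
      then show ?thesis
        using mult_right_mono[OF min[of z], of h] \<open>0 < h\<close> by (simp add: mult.commute)
    qed
  qed
  ultimately show ?thesis
    using that[OF x0(1) min] by (simp add: algebra_simps)
qed

lemma smooth_solution_ux_barrier:
  defines "a \<equiv> integral {-pi..pi} pos_log_kernel + 2"
  assumes sol: "smooth_solution (ereal 1) u0 v"
    and init: "(INF x\<in>{-pi..pi}. deriv (v 0) x) \<le> - a"
    and t1: "t1 \<in> {0..<1}"
  shows "\<exists>x\<in>{-pi..pi}. deriv (v t1) x * (1 - t1) \<le> - a"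
  \<comment> \<open>The set of times at which the bound holds is closed; its last time before \<open>t1\<close> is \<open>t1\<close>
     itself, since \<open>vx t x0 * (1 - t)\<close> strictly decreases in \<open>t\<close> at a minimum \<open>x0\<close>. So no
     differentiability of the minimum in time is needed.\<close>
proof -
  define c where "c = integral {-pi..pi} pos_log_kernel"
  have c: "0 \<le> c"
    unfolding c_def using pos_log_kernel_absolutely_integrable pos_log_kernel_nonneg
    by (intro integral_nonneg) (auto simp: absolutely_integrable_on_def)
  obtain vx vxx vtx where
    cont: "continuous_on ({0..<1} \<times> UNIV) (\<lambda>(t, x). vx t x)"
    and vx: "\<And>t x. t \<in> {0..<1} \<Longrightarrow> (v t has_real_derivative vx t x) (at x)"
    and vxx: "\<And>t x. t \<in> {0..<1} \<Longrightarrow> (vx t has_real_derivative vxx t x) (at x)"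
    and vtx: "\<And>t x. t \<in> {0..<1} \<Longrightarrow>
        ((\<lambda>s. vx s x) has_real_derivative vtx t x) (at t within {0..<1})"
    and Lambda: "\<And>t x. t \<in> {0..<1} \<Longrightarrow> (Lambda_inv (v t) has_real_derivative
        - (vtx t x + (vx t x)\<^sup>2 + v t x * vxx t x)) (at x)"
    using smooth_solution_partials[OF sol] by blast
  have per: "v t (x + 2 * pi) = v t x" if "t \<in> {0..<1}" for t x
    using sol that unfolding smooth_solution_def time_interval_ereal by blast
  \<comment> \<open>Keeping the space variable in one compact period makes the projection of
    \<open>K\<close> to time compact, so that a last time exists.\<close>
  define K where "K = {z \<in> {0..t1} \<times> {-pi..pi}. (case z of (t, x) \<Rightarrow> vx t x * (1 - t)) \<le> - a}"
  have "continuous_on ({0..t1} \<times> {-pi..pi}) (\<lambda>(t, x). vx t x)"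
    by (rule continuous_on_subset[OF cont]) (use t1 in auto)
  then have "continuous_on ({0..t1} \<times> {-pi..pi}) (\<lambda>z. case z of (t, x) \<Rightarrow> vx t x * (1 - t))"
    unfolding split_beta by (intro continuous_intros)
  then have "closed K"
    unfolding K_def by (intro continuous_on_closed_Collect_le) (auto intro: closed_Times)
  then have "compact (({0..t1} \<times> {-pi..pi}) \<inter> K)"
    by (intro compact_Int_closed compact_Times compact_Icc)
  moreover have "({0..t1} \<times> {-pi..pi}) \<inter> K = K"
    by (auto simp: K_def)
  ultimately have "compact K"
    by simp
  then have compact: "compact (fst ` K)"
    by (intro compact_continuous_image continuous_intros)
  have z: "0 \<in> {0..<1::real}"
    by simp
  obtain x1 where x1: "x1 \<in> {-pi..pi}" "\<And>y. vx 0 x1 \<le> vx 0 y"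
    using smooth_solution_ux_at_min[of v 0, OF per[OF z] vx[OF z] vxx[OF z] Lambda[OF z]]
    by metis
  \<comment> \<open>The initial infimum is attained at \<open>x1\<close>, which puts time 0 into the
    projection.\<close>
  have "vx 0 x1 \<le> (INF x\<in>{-pi..pi}. deriv (v 0) x)"
    by (rule cINF_greatest) (use x1 DERIV_imp_deriv[OF vx[OF z]] in auto)
  then have "(0, x1) \<in> K"
    using init x1 t1 by (simp add: K_def)
  then have "fst ` K \<noteq> {}"
    by blast
  then obtain s where s: "s \<in> fst ` K" and s_max: "\<And>s'. s' \<in> fst ` K \<Longrightarrow> s' \<le> s"
    using compact_attains_sup[OF compact] by auto
  obtain y where y: "s \<in> {0..t1}" "vx s y * (1 - s) \<le> - a"
    using s by (auto simp: K_def)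
  have s01: "s \<in> {0..<1}"
    using y t1 by auto
  obtain x0 where x0: "x0 \<in> {-pi..pi}" "\<And>y. vx s x0 \<le> vx s y"
      "vtx s x0 \<le> - (vx s x0)\<^sup>2 - c * vx s x0"
    using smooth_solution_ux_at_min[of v s, OF per[OF s01] vx[OF s01] vxx[OF s01] Lambda[OF s01]]
    unfolding c_def by metis
  define n where "n = - vx s x0"
  define q where "q = n * (1 - s)"
  have "vx s x0 * (1 - s) \<le> vx s y * (1 - s)"
    using x0(2)[of y] s01 by (intro mult_right_mono) auto
  then have q: "a \<le> q"
    using y(2) by (simp add: q_def n_def)
  have "s = t1"
  proof (rule ccontr)
    assume "s \<noteq> t1"
    then have "s < t1"
      using y by auto
    have "0 < q"
      using q c by (simp add: a_def flip: c_def)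
    then have "0 < n"
      using s01 by (simp add: q_def zero_less_mult_iff)
    then have "n * (1 - s) \<le> n * 1"
      using s01 by (intro mult_left_mono) auto
    then have "q \<le> n"
      by (simp add: q_def)
    \<comment> \<open>The quantity to bound is the time derivative of
      \<open>vx t x0 * (1 - t)\<close> at \<open>s\<close>, whose second summand \<open>n\<close>
      comes from the factor \<open>1 - t\<close>. It ends up below
      \<open>- (q * (q - 1 - c))\<close>, and \<open>q \<ge> c + 2\<close> makes this negative;
      hence the constant 2 in \<open>a\<close>.\<close>
    have "vtx s x0 * (1 - s) \<le> (- n\<^sup>2 + c * n) * (1 - s)"
      using x0(3) s01 by (intro mult_right_mono) (auto simp: n_def)
    also have "\<dots> = - (n * q) + c * q"
      by (simp add: q_def algebra_simps power2_eq_square)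
    finally have "vtx s x0 * (1 - s) + n \<le> - (n * (q - 1)) + c * q"
      by (simp add: algebra_simps)
    also have "\<dots> \<le> - (q * (q - 1)) + c * q"
      using \<open>q \<le> n\<close> q c by (simp add: a_def mult_right_mono flip: c_def)
    also have "\<dots> = - (q * (q - 1 - c))"
      by (simp add: algebra_simps)
    also have "\<dots> < 0"
      using \<open>0 < q\<close> q by (simp add: a_def flip: c_def)
    finally have neg: "vtx s x0 * (1 - s) + n < 0" .
    have "((\<lambda>t. vx t x0 * (1 - t)) has_real_derivative vtx s x0 * (1 - s) + n)
        (at s within {0..<1})"
      by (auto intro!: derivative_eq_intros vtx[OF s01] simp: n_def)
    from has_real_derivative_neg_dec_right[OF this neg] obtain d where "0 < d" and
      d: "\<And>h. 0 < h \<Longrightarrow> s + h \<in> {0..<1} \<Longrightarrow> h < d \<Longrightarrow>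
          vx (s + h) x0 * (1 - (s + h)) < vx s x0 * (1 - s)"
      by auto
    \<comment> \<open>Halving \<open>d\<close> gives the strict bound \<open>h < d\<close>, and the
      cap \<open>t1 - s\<close> keeps the later time within the range of \<open>K\<close>,
      contradicting that \<open>s\<close> is last.\<close>
    define h where "h = min (d / 2) (t1 - s)"
    have h: "0 < h" "h < d" "s + h \<le> t1"
      using \<open>0 < d\<close> \<open>s < t1\<close> by (auto simp: h_def)
    then have "vx (s + h) x0 * (1 - (s + h)) < vx s x0 * (1 - s)"
      using s01 t1 by (intro d) auto
    then have "(s + h, x0) \<in> K"
      using q x0(1) h s01 by (auto simp: K_def q_def n_def)
    then have "s + h \<in> fst ` K"
      by force
    with s_max h show False
      by fastforce
  qed
  then show ?thesis
    using q x0(1) DERIV_imp_deriv[OF vx[OF s01]] by (intro bexI[of _ x0]) (auto simp: q_def n_def)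
qed

section \<open>Blow-up no later than time 1\<close>

theorem theorem6:
  shows "\<exists>C::real. \<forall>(T::ereal) (u0::real \<Rightarrow> real) (u::real \<Rightarrow> real \<Rightarrow> real).
           0 < T \<longrightarrow> smooth_solution T u0 u \<longrightarrow>
           (INF x\<in>{-pi..pi}. deriv (u 0) x) \<le> - C \<longrightarrow>
           ux_blows_up T u0 u"
proof -
  define a where "a = integral {-pi..pi} pos_log_kernel + 2"
  have a: "0 < a"
    unfolding a_def using pos_log_kernel_absolutely_integrable pos_log_kernel_nonneg
    by (intro add_nonneg_pos integral_nonneg) (auto simp: absolutely_integrable_on_def)
  have "ux_blows_up T u0 u"
    if T: "0 < T" and u: "smooth_solution T u0 u"
      and init: "(INF x\<in>{-pi..pi}. deriv (u 0) x) \<le> - a" for T u0 u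
  proof -
    \<comment> \<open>The blow-up time is taken to be 1 for all data. The barrier is applied to the
      supposed continuation \<open>v\<close>, which has the same initial slope as
      \<open>u\<close>.\<close>
    have False
      if v: "smooth_solution (ereal 1) u0 v"
        and bdd: "bounded ((\<lambda>(t, x). deriv (v t) x) ` (time_interval (ereal 1) \<times> UNIV))" for v
    proof -
      have "v 0 = u 0"
        using u v by (auto simp: smooth_solution_def)
      then have v_init: "(INF x\<in>{-pi..pi}. deriv (v 0) x) \<le> - a"
        using init by simp
      note barrier = smooth_solution_ux_barrier[OF v v_init[unfolded a_def], folded a_def]
      obtain B where B: "\<And>t x. t \<in> {0..<1} \<Longrightarrow> \<bar>deriv (v t) x\<bar> \<le> B"
        using bdd unfolding time_interval_ereal bounded_iff by fastforce
      have aB: "a \<le> B * (1 - t)" if t: "t \<in> {0..<1}" for t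
      proof -
        obtain x where "deriv (v t) x * (1 - t) \<le> - a"
          using barrier[OF t] by blast
        moreover have "- B * (1 - t) \<le> deriv (v t) x * (1 - t)"
          using B[OF t, of x] t by (intro mult_right_mono) auto
        ultimately show ?thesis
          by simp
      qed
      have "a \<le> B"
        using aB[of 0] by simp
      \<comment> \<open>At this time \<open>B * (1 - t)\<close> equals \<open>a / 2\<close>, too
        small for the barrier; \<open>a \<le> B\<close> ensures that \<open>B\<close> is positive
        and the time admissible.\<close>
      then have "1 - a / (2 * B) \<in> {0..<1}"
        using a by simp
      from aB[OF this] show False
        using a \<open>a \<le> B\<close> by simp
    qed
    then show ?thesis
      unfolding ux_blows_up_def using zero_less_one by blast
  qed
  then show ?thesis
    by blast
qed

end
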